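(* Given a monoid $M$ and a hyperconnected geometric morphism $h:\mathrm{PSh}(M)\to\mathcal{E}$, the corresponding topological monoid $(L,\rho)$ is a (right) powder monoid.
   Context: $\mathrm{PSh}(M)$ is the topos of right $M$-sets. A geometric morphism $h$ is hyperconnected if $h^*$ is full and faithful with essential image closed under subobjects and quotients. A right congruence on $M$ is an equivalence relation $r\subseteq M\times M$ with $(p,q)\in r\Rightarrow(pm,qm)\in r$ for all $m$; $m^*(r)=\{(x,y)\mid(mx,my)\in r\}$. Let $\mathcal{R}_h$ be the inclusion-ordered set of right congruences $r$ such that the right $M$-set $M/r$ is in the essential image of $h^*$ (it is closed under $m^*$). The corresponding monoid is $L=\varprojlim_{r\in\mathcal{R}_h}M/r$ (limit of sets): elements are tuples $\alpha=([a_r])_{r\in\mathcal{R}_h}$ with $[a_r]\in M/r$ and $[a_r]=[a_{r'}]$ in $M/r'$ whenever $r\subseteq r'$, with product $([a_r])_r([b_r])_r=([a_r\,b_{a_r^*(r)}])_r$. (It is the opposite of the monoid of natural endomorphisms of $p^*=U\circ h^*:\mathcal{E}\to\mathbf{Set}$, where $U$ is the forgetful functor.) $\rho$ is the coarsest topology making all projections $L\to M/r$ to discrete sets continuous. For a monoid $N$, $A\subseteq N$, $p\in N$: $p^*(A)=\{m\mid pm\in A\}$, $\mathcal{I}_A^p=\{m\mid m^*(A)=p^*(A)\}$. A topology $\sigma$ on $N$ is an action topology if it coincides with the topology having base $\{A\mid\forall p,q,\ \mathcal{I}^p_{q^*(A)}\in\sigma\}$. A (right) powder monoid is a $T_0$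 topological monoid whose topology is an action topology. *)

theory Defs
  imports "HOL-Analysis.Analysis" "HOL-Algebra.Group"
begin

section \<open>Categories and functors\<close>

text \<open>\<open>Comp C g f\<close> is the composite \<open>g \<circ> f\<close>.\<close>

record ('o, 'm) cat =
  Obj :: "'o set"
  Arr :: "'m set"
  Dom :: "'m \<Rightarrow> 'o"
  Cod :: "'m \<Rightarrow> 'o"
  Ident :: "'o \<Rightarrow> 'm"
  Comp :: "'m \<Rightarrow> 'm \<Rightarrow> 'm" (infixr \<open>\<Zcomp>\<index>\<close> 70)

definition Hom :: "('o, 'm) cat \<Rightarrow> 'o \<Rightarrow> 'o \<Rightarrow> 'm set" where
  "Hom C A B = {f \<in> Arr C. Dom C f = A \<and> Cod C f = B}"

locale category =
  fixes C :: "('o, 'm) cat" (structure)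
  assumes dom_obj: "f \<in> Arr C \<Longrightarrow> Dom C f \<in> Obj C"
    and cod_obj: "f \<in> Arr C \<Longrightarrow> Cod C f \<in> Obj C"
    and ident_hom: "A \<in> Obj C \<Longrightarrow> Ident C A \<in> Hom C A A"
    and comp_hom: "f \<in> Hom C A B \<Longrightarrow> g \<in> Hom C B D \<Longrightarrow> g \<Zcomp> f \<in> Hom C A D"
    and comp_ident_right: "f \<in> Hom C A B \<Longrightarrow> f \<Zcomp> Ident C A = f"
    and comp_ident_left: "f \<in> Hom C A B \<Longrightarrow> Ident C B \<Zcomp> f = f"
    and comp_assoc: "f \<in> Hom C A B \<Longrightarrow> g \<in> Hom C B D \<Longrightarrow> k \<in> Hom C D F \<Longrightarrow>
      (k \<Zcomp> g) \<Zcomp> f = k \<Zcomp> (g \<Zcomp> f)"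

definition monic :: "('o, 'm) cat \<Rightarrow> 'm \<Rightarrow> bool" where
  "monic C m \<longleftrightarrow> m \<in> Arr C \<and>
    (\<forall>W. \<forall>f \<in> Hom C W (Dom C m). \<forall>g \<in> Hom C W (Dom C m).
      m \<Zcomp>\<^bsub>C\<^esub> f = m \<Zcomp>\<^bsub>C\<^esub> g \<longrightarrow> f = g)"

definition epic :: "('o, 'm) cat \<Rightarrow> 'm \<Rightarrow> bool" where
  "epic C e \<longleftrightarrow> e \<in> Arr C \<and>
    (\<forall>W. \<forall>f \<in> Hom C (Cod C e) W. \<forall>g \<in> Hom C (Cod C e) W.
      f \<Zcomp>\<^bsub>C\<^esub> e = g \<Zcomp>\<^bsub>C\<^esub> e \<longrightarrow> f = g)"

definition isomorphic :: "('o, 'm) cat \<Rightarrow> 'o \<Rightarrow> 'o \<Rightarrow> bool" where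
  "isomorphic C A B \<longleftrightarrow> A \<in> Obj C \<and> B \<in> Obj C \<and>
    (\<exists>f \<in> Hom C A B. \<exists>g \<in> Hom C B A.
      g \<Zcomp>\<^bsub>C\<^esub> f = Ident C A \<and> f \<Zcomp>\<^bsub>C\<^esub> g = Ident C B)"

record ('o, 'm, 'p, 'n) cat_functor =
  ob :: "'o \<Rightarrow> 'p"
  ar :: "'m \<Rightarrow> 'n"

definition is_functor ::
  "('o, 'm) cat \<Rightarrow> ('p, 'n) cat \<Rightarrow> ('o, 'm, 'p, 'n) cat_functor \<Rightarrow> bool" where
  "is_functor C D F \<longleftrightarrow> category C \<and> category D \<and>
    (\<forall>A \<in> Obj C. ob F A \<in> Obj D) \<and>
    (\<forall>A B. \<forall>f \<in> Hom C A B. ar F f \<in> Hom D (ob F A) (ob F B)) \<and>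
    (\<forall>A \<in> Obj C. ar F (Ident C A) = Ident D (ob F A)) \<and>
    (\<forall>A B X. \<forall>f \<in> Hom C A B. \<forall>g \<in> Hom C B X.
      ar F (g \<Zcomp>\<^bsub>C\<^esub> f) = ar F g \<Zcomp>\<^bsub>D\<^esub> ar F f)"

definition functor_comp ::
  "('p, 'n, 'q, 'k) cat_functor \<Rightarrow> ('o, 'm, 'p, 'n) cat_functor \<Rightarrow> ('o, 'm, 'q, 'k) cat_functor" where
  "functor_comp G F = \<lparr>ob = ob G \<circ> ob F, ar = ar G \<circ> ar F\<rparr>"

section \<open>Finite limits\<close>

definition is_cone :: "('i, 'j) cat \<Rightarrow> ('o, 'm) cat \<Rightarrow> ('i, 'j, 'o, 'm) cat_functor \<Rightarrow>
    'o \<Rightarrow> ('i \<Rightarrow> 'm) \<Rightarrow> bool" where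
  "is_cone J C D V l \<longleftrightarrow> V \<in> Obj C \<and>
    (\<forall>j \<in> Obj J. l j \<in> Hom C V (ob D j)) \<and>
    (\<forall>u \<in> Arr J. ar D u \<Zcomp>\<^bsub>C\<^esub> l (Dom J u) = l (Cod J u))"

definition is_limit :: "('i, 'j) cat \<Rightarrow> ('o, 'm) cat \<Rightarrow> ('i, 'j, 'o, 'm) cat_functor \<Rightarrow>
    'o \<Rightarrow> ('i \<Rightarrow> 'm) \<Rightarrow> bool" where
  "is_limit J C D V l \<longleftrightarrow> is_cone J C D V l \<and>
    (\<forall>W k. is_cone J C D W k \<longrightarrow>
      (\<exists>!t. t \<in> Hom C W V \<and> (\<forall>j \<in> Obj J. l j \<Zcomp>\<^bsub>C\<^esub> t = k j)))"

text \<open>Every finite category is isomorphic to one whose objects and arrows are natural numbers,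
  so it suffices to let the shape \<open>J\<close> range over these.\<close>

definition finite_category :: "(nat, nat) cat \<Rightarrow> bool" where
  "finite_category J \<longleftrightarrow> category J \<and> finite (Obj J) \<and> finite (Arr J)"

definition has_finite_limits :: "('o, 'm) cat \<Rightarrow> bool" where
  "has_finite_limits C \<longleftrightarrow> (\<forall>J D. finite_category J \<and> is_functor J C D \<longrightarrow>
    (\<exists>V l. is_limit J C D V l))"

definition preserves_finite_limits ::
  "('o, 'm) cat \<Rightarrow> ('p, 'n) cat \<Rightarrow> ('o, 'm, 'p, 'n) cat_functor \<Rightarrow> bool" where
  "preserves_finite_limits C C' F \<longleftrightarrow> (\<forall>J D V l.
    finite_category J \<and> is_functor J C D \<and> is_limit J C D V l \<longrightarrow>
    is_limit J C' (functor_comp F D) (ob F V) (ar F \<circ> l))"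

section \<open>Elementary toposes\<close>

definition is_terminal :: "('o, 'm) cat \<Rightarrow> 'o \<Rightarrow> bool" where
  "is_terminal C T \<longleftrightarrow> T \<in> Obj C \<and> (\<forall>A \<in> Obj C. \<exists>!f. f \<in> Hom C A T)"

definition is_product :: "('o, 'm) cat \<Rightarrow> 'o \<Rightarrow> 'o \<Rightarrow> 'o \<Rightarrow> 'm \<Rightarrow> 'm \<Rightarrow> bool" where
  "is_product C A B P p q \<longleftrightarrow> p \<in> Hom C P A \<and> q \<in> Hom C P B \<and>
    (\<forall>W. \<forall>f \<in> Hom C W A. \<forall>g \<in> Hom C W B.
      \<exists>!t. t \<in> Hom C W P \<and> p \<Zcomp>\<^bsub>C\<^esub> t = f \<and> q \<Zcomp>\<^bsub>C\<^esub> t = g)"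

text \<open>\<open>is_pullback C f g p q\<close>: the arrows \<open>p\<close>, \<open>q\<close> form a pullback of the cospan
  \<open>f\<close>, \<open>g\<close>, with \<open>f \<circ> p = g \<circ> q\<close>.\<close>

definition is_pullback :: "('o, 'm) cat \<Rightarrow> 'm \<Rightarrow> 'm \<Rightarrow> 'm \<Rightarrow> 'm \<Rightarrow> bool" where
  "is_pullback C f g p q \<longleftrightarrow> f \<in> Arr C \<and> g \<in> Arr C \<and> Cod C f = Cod C g \<and>
    p \<in> Hom C (Dom C p) (Dom C f) \<and> q \<in> Hom C (Dom C p) (Dom C g) \<and>
    f \<Zcomp>\<^bsub>C\<^esub> p = g \<Zcomp>\<^bsub>C\<^esub> q \<and>
    (\<forall>W. \<forall>a \<in> Hom C W (Dom C f). \<forall>b \<in> Hom C W (Dom C g). f \<Zcomp>\<^bsub>C\<^esub> a = g \<Zcomp>\<^bsub>C\<^esub> b \<longrightarrow>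
      (\<exists>!t. t \<in> Hom C W (Dom C p) \<and> p \<Zcomp>\<^bsub>C\<^esub> t = a \<and> q \<Zcomp>\<^bsub>C\<^esub> t = b))"

text \<open>In \<open>is_exponential C A B X P p q ev\<close> the object \<open>X\<close> is \<open>B\<^sup>A\<close>, \<open>P\<close> is a product
  \<open>X \<times> A\<close> and \<open>ev : P \<rightarrow> B\<close> is evaluation; the arrow \<open>t\<close> is \<open>g \<times> id\<close>, which
  is determined by \<open>g\<close>.\<close>

definition is_exponential ::
  "('o, 'm) cat \<Rightarrow> 'o \<Rightarrow> 'o \<Rightarrow> 'o \<Rightarrow> 'o \<Rightarrow> 'm \<Rightarrow> 'm \<Rightarrow> 'm \<Rightarrow> bool" where
  "is_exponential C A B X P p q ev \<longleftrightarrow> is_product C X A P p q \<and> ev \<in> Hom C P B \<and>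
    (\<forall>W Q p' q' f. is_product C W A Q p' q' \<and> f \<in> Hom C Q B \<longrightarrow>
      (\<exists>!g. g \<in> Hom C W X \<and>
        (\<exists>t \<in> Hom C Q P. p \<Zcomp>\<^bsub>C\<^esub> t = g \<Zcomp>\<^bsub>C\<^esub> p' \<and> q \<Zcomp>\<^bsub>C\<^esub> t = q' \<and>
          ev \<Zcomp>\<^bsub>C\<^esub> t = f)))"

definition has_exponentials :: "('o, 'm) cat \<Rightarrow> bool" where
  "has_exponentials C \<longleftrightarrow> (\<forall>A \<in> Obj C. \<forall>B \<in> Obj C.
    \<exists>X P p q ev. is_exponential C A B X P p q ev)"

definition is_subobject_classifier :: "('o, 'm) cat \<Rightarrow> 'o \<Rightarrow> 'm \<Rightarrow> bool" where
  "is_subobject_classifier C \<Omega> tr \<longleftrightarrow>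
    tr \<in> Arr C \<and> is_terminal C (Dom C tr) \<and> Cod C tr = \<Omega> \<and>
    (\<forall>m. monic C m \<longrightarrow>
      (\<exists>!c. c \<in> Hom C (Cod C m) \<Omega> \<and>
        (\<exists>u \<in> Hom C (Dom C m) (Dom C tr). is_pullback C c tr m u)))"

definition topos :: "('o, 'm) cat \<Rightarrow> bool" where
  "topos C \<longleftrightarrow> category C \<and> has_finite_limits C \<and> has_exponentials C \<and>
    (\<exists>\<Omega> tr. is_subobject_classifier C \<Omega> tr)"

section \<open>Hyperconnected geometric morphisms\<close>

definition left_adjoint :: "('o, 'm) cat \<Rightarrow> ('p, 'n) cat \<Rightarrow>
    ('o, 'm, 'p, 'n) cat_functor \<Rightarrow> ('p, 'n, 'o, 'm) cat_functor \<Rightarrow> bool" where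
  "left_adjoint C D F G \<longleftrightarrow> is_functor C D F \<and> is_functor D C G \<and>
    (\<exists>\<phi>. (\<forall>A \<in> Obj C. \<forall>X \<in> Obj D. bij_betw (\<phi> A X) (Hom D (ob F A) X) (Hom C A (ob G X))) \<and>
      (\<forall>A \<in> Obj C. \<forall>A' \<in> Obj C. \<forall>X \<in> Obj D. \<forall>X' \<in> Obj D.
        \<forall>a \<in> Hom C A' A. \<forall>x \<in> Hom D X X'. \<forall>f \<in> Hom D (ob F A) X.
          \<phi> A' X' (x \<Zcomp>\<^bsub>D\<^esub> (f \<Zcomp>\<^bsub>D\<^esub> ar F a)) = ar G x \<Zcomp>\<^bsub>C\<^esub> (\<phi> A X f \<Zcomp>\<^bsub>C\<^esub> a)))"

record ('p, 'n, 'o, 'm) geom_morphism =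
  inverse_image :: "('o, 'm, 'p, 'n) cat_functor"
  direct_image :: "('p, 'n, 'o, 'm) cat_functor"

text \<open>\<open>is_geometric_morphism F E h\<close>: \<open>h\<close> goes from \<open>F\<close> to \<open>E\<close>, so its inverse image goes
  from \<open>E\<close> to \<open>F\<close>.\<close>

definition is_geometric_morphism ::
  "('p, 'n) cat \<Rightarrow> ('o, 'm) cat \<Rightarrow> ('p, 'n, 'o, 'm) geom_morphism \<Rightarrow> bool" where
  "is_geometric_morphism F E h \<longleftrightarrow>
    left_adjoint E F (inverse_image h) (direct_image h) \<and>
    preserves_finite_limits E F (inverse_image h)"

definition full_and_faithful ::
  "('o, 'm) cat \<Rightarrow> ('p, 'n) cat \<Rightarrow> ('o, 'm, 'p, 'n) cat_functor \<Rightarrow> bool" where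
  "full_and_faithful C D F \<longleftrightarrow> (\<forall>A \<in> Obj C. \<forall>B \<in> Obj C.
    bij_betw (ar F) (Hom C A B) (Hom D (ob F A) (ob F B)))"

definition essential_image ::
  "('o, 'm) cat \<Rightarrow> ('p, 'n) cat \<Rightarrow> ('o, 'm, 'p, 'n) cat_functor \<Rightarrow> 'p set" where
  "essential_image C D F = {X \<in> Obj D. \<exists>A \<in> Obj C. isomorphic D X (ob F A)}"

definition closed_under_subobjects :: "('o, 'm) cat \<Rightarrow> 'o set \<Rightarrow> bool" where
  "closed_under_subobjects C S \<longleftrightarrow> (\<forall>m. monic C m \<and> Cod C m \<in> S \<longrightarrow> Dom C m \<in> S)"

definition closed_under_quotients :: "('o, 'm) cat \<Rightarrow> 'o set \<Rightarrow> bool" where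
  "closed_under_quotients C S \<longleftrightarrow> (\<forall>e. epic C e \<and> Dom C e \<in> S \<longrightarrow> Cod C e \<in> S)"

definition hyperconnected ::
  "('p, 'n) cat \<Rightarrow> ('o, 'm) cat \<Rightarrow> ('p, 'n, 'o, 'm) geom_morphism \<Rightarrow> bool" where
  "hyperconnected F E h \<longleftrightarrow> is_geometric_morphism F E h \<and>
    full_and_faithful E F (inverse_image h) \<and>
    closed_under_subobjects F (essential_image E F (inverse_image h)) \<and>
    closed_under_quotients F (essential_image E F (inverse_image h))"

section \<open>Small sets\<close>

text \<open>The category of sets, hence also that of right \<open>M\<close>-sets, is taken relative to a
  Grothendieck universe: a collection \<open>U\<close> of subsets of a type \<open>'u\<close>, the small sets,
  closed under the operations below. A set of any type is small if it is in bijection with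
  a member of \<open>U\<close>. Closure under pairs and products follows, since \<open>U\<close> contains
  small copies of iterated power sets. An infinite member is not required, so that the finite
  subsets of an infinite type are also allowed.\<close>

definition small :: "'u set set \<Rightarrow> 'b set \<Rightarrow> bool" where
  "small U A \<longleftrightarrow> (\<exists>f. inj_on f A \<and> f ` A \<in> U)"

locale universe =
  fixes U :: "'u set set"
  assumes singleton: "{x} \<in> U"
    and subset: "X \<in> U \<Longrightarrow> Y \<subseteq> X \<Longrightarrow> Y \<in> U"
    and replacement: "X \<in> U \<Longrightarrow> f ` X \<in> U"
    and power: "X \<in> U \<Longrightarrow> small U (Pow X)"
    and union: "I \<in> U \<Longrightarrow> (\<And>i. i \<in> I \<Longrightarrow> A i \<in> U) \<Longrightarrow> (\<Union>i\<in>I. A i) \<in> U"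

section \<open>Right \<open>M\<close>-sets\<close>

record ('x, 'a) mset =
  points :: "'x set"
  act :: "'x \<Rightarrow> 'a \<Rightarrow> 'x"

definition right_mset :: "('a, 'b) monoid_scheme \<Rightarrow> ('x, 'a) mset \<Rightarrow> bool" where
  "right_mset M X \<longleftrightarrow>
    (\<forall>x \<in> points X. \<forall>m \<in> carrier M. act X x m \<in> points X) \<and>
    (\<forall>x \<in> points X. act X x \<one>\<^bsub>M\<^esub> = x) \<and>
    (\<forall>x \<in> points X. \<forall>m \<in> carrier M. \<forall>n \<in> carrier M.
      act X x (m \<otimes>\<^bsub>M\<^esub> n) = act X (act X x m) n)"

definition equivariant ::
  "('a, 'b) monoid_scheme \<Rightarrow> ('x, 'a) mset \<Rightarrow> ('y, 'a) mset \<Rightarrow> ('x \<Rightarrow> 'y) \<Rightarrow> bool" where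
  "equivariant M X Y f \<longleftrightarrow> f \<in> points X \<rightarrow> points Y \<and>
    (\<forall>x \<in> points X. \<forall>m \<in> carrier M. f (act X x m) = act Y (f x) m)"

text \<open>An arrow of \<open>PSh(M)\<close> is a triple of domain, extensional map and codomain.\<close>

definition PSh :: "'u set set \<Rightarrow> ('a, 'b) monoid_scheme \<Rightarrow>
    (('u, 'a) mset, ('u, 'a) mset \<times> ('u \<Rightarrow> 'u) \<times> ('u, 'a) mset) cat" where
  "PSh U M = \<lparr>
    Obj = {X. right_mset M X \<and> points X \<in> U},
    Arr = {(X, f, Y). right_mset M X \<and> points X \<in> U \<and> right_mset M Y \<and> points Y \<in> U \<and>
             equivariant M X Y f \<and> f \<in> extensional (points X)},
    Dom = (\<lambda>(X, f, Y). X),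
    Cod = (\<lambda>(X, f, Y). Y),
    Ident = (\<lambda>X. (X, restrict (\<lambda>x. x) (points X), X)),
    Comp = (\<lambda>(Y', g, Z) (X, f, Y). (X, compose (points X) g f, Z))\<rparr>"

section \<open>The monoid \<open>L\<close> and its topology\<close>

definition right_congruence :: "('a, 'b) monoid_scheme \<Rightarrow> ('a \<times> 'a) set \<Rightarrow> bool" where
  "right_congruence M r \<longleftrightarrow> equiv (carrier M) r \<and>
    (\<forall>p q. \<forall>m \<in> carrier M. (p, q) \<in> r \<longrightarrow> (p \<otimes>\<^bsub>M\<^esub> m, q \<otimes>\<^bsub>M\<^esub> m) \<in> r)"

text \<open>Maps out of \<open>M/r\<close> are defined as unions over all representatives, as in
  \<^theory>\<open>HOL.Equiv_Relations\<close>: here \<open>[a] m = [a m]\<close>.\<close>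

definition quotient_mset :: "('a, 'b) monoid_scheme \<Rightarrow> ('a \<times> 'a) set \<Rightarrow> ('a set, 'a) mset" where
  "quotient_mset M r = \<lparr>
    points = carrier M // r,
    act = (\<lambda>c m. \<Union>a\<in>c. r `` {a \<otimes>\<^bsub>M\<^esub> m})\<rparr>"

definition pull_cong :: "('a, 'b) monoid_scheme \<Rightarrow> 'a \<Rightarrow> ('a \<times> 'a) set \<Rightarrow> ('a \<times> 'a) set" where
  "pull_cong M m r =
    {(x, y). x \<in> carrier M \<and> y \<in> carrier M \<and> (m \<otimes>\<^bsub>M\<^esub> x, m \<otimes>\<^bsub>M\<^esub> y) \<in> r}"

text \<open>The points of \<open>M/r\<close> are sets of elements of \<open>M\<close> rather than elements of the type
  underlying the universe, so \<open>M/r\<close> belongs to the essential image of the inverse image functor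
  if it is isomorphic, as a right \<open>M\<close>-set, to an object in this essential image.\<close>

definition congs_of :: "'u set set \<Rightarrow> ('a, 'b) monoid_scheme \<Rightarrow> ('o, 'm) cat \<Rightarrow>
    (('u, 'a) mset, ('u, 'a) mset \<times> ('u \<Rightarrow> 'u) \<times> ('u, 'a) mset, 'o, 'm) geom_morphism \<Rightarrow>
    ('a \<times> 'a) set set" where
  "congs_of U M E h = {r. right_congruence M r \<and>
    (\<exists>X \<in> essential_image E (PSh U M) (inverse_image h). \<exists>f.
      equivariant M (quotient_mset M r) X f \<and>
      bij_betw f (points (quotient_mset M r)) (points X))}"

text \<open>For \<open>r \<subseteq> r'\<close> the projection \<open>M/r \<rightarrow> M/r'\<close> sends a class \<open>c\<close> to \<open>r' `` c\<close>. The
  \<open>r\<close>-component of a product is \<open>[a b]\<close> for \<open>a\<close> representing \<open>\<alpha> r\<close> and \<open>b\<close> representing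
  \<open>\<beta>\<close> at the pullback of \<open>r\<close> along \<open>a\<close>.\<close>

definition limit_monoid ::
  "('a, 'b) monoid_scheme \<Rightarrow> ('a \<times> 'a) set set \<Rightarrow> (('a \<times> 'a) set \<Rightarrow> 'a set) monoid" where
  "limit_monoid M R = \<lparr>
    carrier = {\<alpha> \<in> (\<Pi>\<^sub>E r\<in>R. carrier M // r).
      \<forall>r\<in>R. \<forall>r'\<in>R. r \<subseteq> r' \<longrightarrow> r' `` (\<alpha> r) = \<alpha> r'},
    mult = (\<lambda>\<alpha> \<beta>. \<lambda>r\<in>R. \<Union>a\<in>\<alpha> r. \<Union>b\<in>\<beta> (pull_cong M a r). r `` {a \<otimes>\<^bsub>M\<^esub> b}),
    one = (\<lambda>r\<in>R. r `` {\<one>\<^bsub>M\<^esub>})\<rparr>"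

text \<open>The whole carrier is listed among the generators only to fix the underlying set.\<close>

definition limit_topology ::
  "('a, 'b) monoid_scheme \<Rightarrow> ('a \<times> 'a) set set \<Rightarrow> (('a \<times> 'a) set \<Rightarrow> 'a set) topology" where
  "limit_topology M R = topology_generated_by
    (insert (carrier (limit_monoid M R))
      {{\<alpha> \<in> carrier (limit_monoid M R). \<alpha> r \<in> S} | r S. r \<in> R \<and> S \<subseteq> carrier M // r})"

section \<open>Powder monoids\<close>

definition pull_set :: "('n, 'b) monoid_scheme \<Rightarrow> 'n \<Rightarrow> 'n set \<Rightarrow> 'n set" where
  "pull_set N p A = {m \<in> carrier N. p \<otimes>\<^bsub>N\<^esub> m \<in> A}"

text \<open>\<open>nec_clopen N A p\<close> is the set \<open>\<I>\<^sub>A\<^sup>p\<close> (a necessary clopen).\<close>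

definition nec_clopen :: "('n, 'b) monoid_scheme \<Rightarrow> 'n set \<Rightarrow> 'n \<Rightarrow> 'n set" where
  "nec_clopen N A p = {m \<in> carrier N. pull_set N m A = pull_set N p A}"

definition action_base :: "('n, 'b) monoid_scheme \<Rightarrow> 'n topology \<Rightarrow> 'n set set" where
  "action_base N T = {A. A \<subseteq> carrier N \<and>
    (\<forall>p \<in> carrier N. \<forall>q \<in> carrier N. openin T (nec_clopen N (pull_set N q A) p))}"

definition action_topology :: "('n, 'b) monoid_scheme \<Rightarrow> 'n topology \<Rightarrow> bool" where
  "action_topology N T \<longleftrightarrow> topspace T = carrier N \<and>
    openin T = arbitrary union_of (\<lambda>A. A \<in> action_base N T)"

definition topological_monoid :: "('n, 'b) monoid_scheme \<Rightarrow> 'n topology \<Rightarrow> bool" where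
  "topological_monoid N T \<longleftrightarrow> monoid N \<and> topspace T = carrier N \<and>
    continuous_map (prod_topology T T) T (\<lambda>(x, y). x \<otimes>\<^bsub>N\<^esub> y)"

definition powder_monoid :: "('n, 'b) monoid_scheme \<Rightarrow> 'n topology \<Rightarrow> bool" where
  "powder_monoid N T \<longleftrightarrow> topological_monoid N T \<and> t0_space T \<and> action_topology N T"

end

theory Submission
  imports Defs
begin

text \<open>The only property of the set of congruences that matters is closure under the pullbacks
  \<open>r \<mapsto> m\<^sup>*(r)\<close>, which holds because \<open>M/m\<^sup>*(r)\<close> embeds in \<open>M/r\<close> by left multiplication with \<open>m\<close>.
  The \<open>r\<close>-component of a product \<open>\<alpha> \<beta>\<close> depends only on the \<open>r\<close>-component of \<open>\<alpha>\<close> and, once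
  \<open>a \<in> \<alpha> r\<close> is chosen, on the \<open>a\<^sup>*(r)\<close>-component of \<open>\<beta>\<close>; this gives continuity, and it also
  shows that the subbasic open sets lie in the base of the action topology. Conversely every
  member \<open>A\<close> of that base is open, because \<open>p \<in> \<I>\<^sub>A\<^sup>p \<subseteq> A\<close> for all \<open>p \<in> A\<close>.\<close>

section \<open>Action topologies\<close>

text \<open>Pulling back along left multiplication commutes with intersection, so elements that
  induce the same pullbacks of two sets separately also induce the same pullback of their
  intersection. This makes the unions of base members a topology.\<close>

lemma action_base_Int:
  assumes "A \<in> action_base N T" "B \<in> action_base N T"
  shows "A \<inter> B \<in> action_base N T"
proof -
  have pull_Int: "pull_set N q (A \<inter> B) = pull_set N q A \<inter> pull_set N q B" for A B q
    by (auto simp: pull_set_def)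
  have "openin T (nec_clopen N (pull_set N q (A \<inter> B)) p)" (is "openin T ?I")
    if "p \<in> carrier N" "q \<in> carrier N" for p q
  proof (subst openin_subopen, intro ballI)
    fix m assume m: "m \<in> ?I"
    \<comment> \<open>The neighbourhood is centred at \<open>m\<close> and not at \<open>p\<close>:
      that \<open>m\<close> and \<open>p\<close> give equal pullbacks of the intersection does not
      make their pullbacks of the two sets separately equal.\<close>
    let ?W = "nec_clopen N (pull_set N q A) m \<inter> nec_clopen N (pull_set N q B) m"
    have mN: "m \<in> carrier N"
      using m by (simp add: nec_clopen_def)
    have "openin T ?W"
      using assms that mN by (intro openin_Int) (auto simp: action_base_def)
    moreover have "m \<in> ?W"
      using mN by (simp add: nec_clopen_def)
    moreover have "?W \<subseteq> ?I"
      using m by (auto simp: nec_clopen_def pull_Int)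
    ultimately show "\<exists>V. openin T V \<and> m \<in> V \<and> V \<subseteq> ?I"
      by blast
  qed
  then show ?thesis
    using assms by (auto simp: action_base_def)
qed

lemma carrier_in_action_base:
  assumes "monoid N" "topspace T = carrier N"
  shows "carrier N \<in> action_base N T"
proof -
  interpret monoid N by fact
  have "pull_set N p (carrier N) = carrier N" if "p \<in> carrier N" for p
    using that by (auto simp: pull_set_def)
  then have "nec_clopen N (pull_set N q (carrier N)) p = topspace T"
    if "p \<in> carrier N" "q \<in> carrier N" for p q
    using that assms(2) by (auto simp: nec_clopen_def)
  then show ?thesis
    by (simp add: action_base_def)
qed

lemma action_base_openin:
  assumes "monoid N" "A \<in> action_base N T"
  shows "openin T A"
proof (subst openin_subopen, intro ballI)
  interpret monoid N by fact
  fix p assume p: "p \<in> A"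
  have A: "A \<subseteq> carrier N"
    using assms(2) by (simp add: action_base_def)
  \<comment> \<open>The base condition speaks only of the pullbacks \<open>pull_set N q A\<close>;
    the case of the unit recovers \<open>A\<close> itself.\<close>
  have one: "pull_set N \<one>\<^bsub>N\<^esub> A = A"
    using A by (auto simp: pull_set_def)
  have "openin T (nec_clopen N (pull_set N \<one>\<^bsub>N\<^esub> A) p)"
    using assms(2) A p by (auto simp: action_base_def)
  moreover have "p \<in> nec_clopen N A p"
    using A p by (auto simp: nec_clopen_def)
  moreover have "nec_clopen N A p \<subseteq> A"
  proof
    fix m assume m: "m \<in> nec_clopen N A p"
    \<comment> \<open>The unit detects membership: it lies in the pullback of \<open>A\<close> along
      an element exactly when that element lies in \<open>A\<close>.\<close>
    have "\<one>\<^bsub>N\<^esub> \<in> pull_set N p A"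
      using A p by (auto simp: pull_set_def)
    then have "\<one>\<^bsub>N\<^esub> \<in> pull_set N m A"
      using m by (simp add: nec_clopen_def)
    then show "m \<in> A"
      using m by (simp add: pull_set_def nec_clopen_def)
  qed
  ultimately show "\<exists>V. openin T V \<and> p \<in> V \<and> V \<subseteq> A"
    unfolding one by blast
qed

text \<open>Checking generators suffices: unions of base members are closed under finite
  intersections and arbitrary unions, hence exhaust the generated topology, while every base member
  is open.\<close>

lemma action_topologyI:
  assumes "monoid (N :: ('n, 'b) monoid_scheme)"
    and "topspace (topology_generated_by \<B>) = carrier N"
    and "\<B> \<subseteq> action_base N (topology_generated_by \<B>)"
  shows "action_topology N (topology_generated_by \<B>)"
proof -
  let ?T = "topology_generated_by \<B>"
  let ?P = "\<lambda>A. A \<in> action_base N ?T"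
  have base_Int: "(arbitrary union_of ?P) (A \<inter> B)"
    if "(arbitrary union_of ?P) A" "(arbitrary union_of ?P) B" for A B
    using istopology_base[of ?P, OF action_base_Int] that by (simp add: istopology_def)
  have "(arbitrary union_of ?P) A" if "openin ?T A" for A
    using openin_topology_generated_by[OF that]
  proof induction
    case Empty
    show ?case
      by simp
  next
    case (Int a b)
    then show ?case
      by (intro base_Int)
  next
    case (UN K)
    then show ?case
      by (intro arbitrary_union_of_Union)
  next
    case (Basis s)
    then have "?P s"
      using assms(3) by blast
    then show ?case
      by (rule arbitrary_union_of_inc)
  qed
  moreover have "openin ?T A" if "(arbitrary union_of ?P) A" for A
    using that action_base_openin[OF assms(1)] by (auto simp: union_of_def)
  ultimately show ?thesis
    using assms(2) unfolding action_topology_def by blast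
qed

section \<open>Pullbacks of right congruences\<close>

lemma right_congruence_mult:
  assumes "right_congruence M r" "(x, y) \<in> r" "m \<in> carrier M"
  shows "(x \<otimes>\<^bsub>M\<^esub> m, y \<otimes>\<^bsub>M\<^esub> m) \<in> r"
  using assms by (simp add: right_congruence_def)

lemma right_congruence_equiv: "right_congruence M r \<Longrightarrow> equiv (carrier M) r"
  by (simp add: right_congruence_def)

lemma right_congruence_subset: "right_congruence M r \<Longrightarrow> r \<subseteq> carrier M \<times> carrier M"
  by (simp add: right_congruence_def equiv_def)

context monoid
begin

lemma right_congruence_pull_cong:
  assumes r: "right_congruence G r" and m: "m \<in> carrier G"
  shows "right_congruence G (pull_cong G m r)"
proof -
  have e: "equiv (carrier G) r"
    using r by (rule right_congruence_equiv)
  have "equiv (carrier G) (pull_cong G m r)"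
  proof (rule equivI)
    show "refl_on (carrier G) (pull_cong G m r)"
      using e m by (auto simp: pull_cong_def equiv_def refl_on_def)
    have "sym r" "trans r"
      using e by (simp_all add: equiv_def)
    then show "sym (pull_cong G m r)" "trans (pull_cong G m r)"
      unfolding sym_def trans_def pull_cong_def by blast+
  qed (auto simp: pull_cong_def)
  moreover have "(p \<otimes> n, q \<otimes> n) \<in> pull_cong G m r"
    if "n \<in> carrier G" "(p, q) \<in> pull_cong G m r" for n p q
    using that m right_congruence_mult[OF r, of "m \<otimes> p" "m \<otimes> q" n]
    by (simp add: pull_cong_def m_assoc)
  ultimately show ?thesis
    by (simp add: right_congruence_def)
qed

lemma pull_cong_one: "right_congruence G r \<Longrightarrow> pull_cong G \<one> r = r"
  using right_congruence_subset[of G r] by (auto simp: pull_cong_def)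

text \<open>This contravariance is what associativity of the product of \<open>L\<close> rests
  on.\<close>

lemma pull_cong_mult:
  "a \<in> carrier G \<Longrightarrow> b \<in> carrier G \<Longrightarrow>
    pull_cong G (a \<otimes> b) r = pull_cong G b (pull_cong G a r)"
  by (auto simp: pull_cong_def m_assoc)

lemma pull_cong_mono: "r \<subseteq> s \<Longrightarrow> pull_cong G a r \<subseteq> pull_cong G a s"
  by (auto simp: pull_cong_def)

text \<open>Right multiplication by \<open>x\<close> and by \<open>y\<close> keeps \<open>a\<close>
  and \<open>a'\<close> related, so the two membership conditions are equivalent. Hence the index at
  which the second factor of a product is evaluated depends only on the class of
  \<open>a\<close>.\<close>

lemma pull_cong_cong:
  assumes r: "right_congruence G r" and aa': "(a, a') \<in> r"
  shows "pull_cong G a r = pull_cong G a' r"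
proof -
  have e: "equiv (carrier G) r"
    using r by (rule right_congruence_equiv)
  have *: "(a \<otimes> x, a' \<otimes> x) \<in> r" if "x \<in> carrier G" for x
    using right_congruence_mult[OF r aa' that] .
  have "(a \<otimes> x, a \<otimes> y) \<in> r \<longleftrightarrow> (a' \<otimes> x, a' \<otimes> y) \<in> r" if "x \<in> carrier G" "y \<in> carrier G" for x y
    using equiv_class_eq[OF e *[OF that(1)]] equiv_class_eq[OF e *[OF that(2)]]
      equiv_class_eq_iff[OF e] *[OF that(1)] *[OF that(2)] by metis
  then show ?thesis
    by (auto simp: pull_cong_def)
qed

lemma act_quotient_mset:
  assumes r: "right_congruence G r" and x: "x \<in> carrier G" and m: "m \<in> carrier G"
  shows "act (quotient_mset G r) (r `` {x}) m = r `` {x \<otimes> m}"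
proof -
  have e: "equiv (carrier G) r"
    using r by (rule right_congruence_equiv)
  have "r `` {a \<otimes> m} = r `` {x \<otimes> m}" if "a \<in> r `` {x}" for a
    using right_congruence_mult[OF r _ m, of x a] that equiv_class_eq[OF e, of "x \<otimes> m" "a \<otimes> m"]
    by simp
  moreover have "x \<in> r `` {x}"
    using e x by (rule equiv_class_self)
  ultimately have "(\<Union>a\<in>r `` {x}. r `` {a \<otimes> m}) = r `` {x \<otimes> m}"
    by blast
  then show ?thesis
    by (simp add: quotient_mset_def)
qed

end

section \<open>The limit monoid of a pullback-closed set of congruences\<close>

text \<open>The assumption \<open>pull\<close> gives the product its meaning: the second factor is
  evaluated at \<open>pull_cong M a r\<close>, and elements of \<open>L\<close> carry information
  only at indices in \<open>R\<close>.\<close>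

locale pull_closed_congruences = monoid M for M (structure) +
  fixes R :: "('a \<times> 'a) set set"
  assumes cong: "r \<in> R \<Longrightarrow> right_congruence M r"
    and pull: "r \<in> R \<Longrightarrow> m \<in> carrier M \<Longrightarrow> pull_cong M m r \<in> R"
begin

abbreviation "L \<equiv> limit_monoid M R"

section \<open>Elements of the limit and representatives of their components\<close>

lemma cong_equiv: "r \<in> R \<Longrightarrow> equiv (carrier M) r"
  by (intro right_congruence_equiv cong)

lemma limit_rep:
  assumes "\<alpha> \<in> carrier L" "r \<in> R"
  obtains a where "a \<in> carrier M" "a \<in> \<alpha> r" "\<alpha> r = r `` {a}"
proof -
  have "\<alpha> r \<in> carrier M // r"
    using assms by (auto simp: limit_monoid_def)
  then obtain a where "a \<in> carrier M" "\<alpha> r = r `` {a}"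
    by (auto elim: quotientE)
  then show ?thesis
    using that equiv_class_self[OF cong_equiv[OF assms(2)]] by auto
qed

lemma limit_class:
  assumes "\<alpha> \<in> carrier L" "r \<in> R" "a \<in> \<alpha> r"
  shows "a \<in> carrier M" "\<alpha> r = r `` {a}"
proof -
  obtain a' where a': "a' \<in> carrier M" "\<alpha> r = r `` {a'}"
    using limit_rep[OF assms(1,2)] .
  then have "(a', a) \<in> r"
    using assms by auto
  then show "\<alpha> r = r `` {a}" "a \<in> carrier M"
    using a'(2) equiv_class_eq[OF cong_equiv[OF assms(2)], of a' a]
      right_congruence_subset[OF cong[OF assms(2)]] by auto
qed

lemma limit_mono:
  assumes "\<alpha> \<in> carrier L" "r \<in> R" "r' \<in> R" "r \<subseteq> r'" "a \<in> \<alpha> r"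
  shows "a \<in> \<alpha> r'"
proof -
  have "r' `` \<alpha> r = \<alpha> r'"
    using assms by (auto simp: limit_monoid_def)
  moreover have "(a, a) \<in> r'"
    using limit_class[OF assms(1,2,5)] cong_equiv[OF assms(3)] by (auto simp: equiv_def refl_on_def)
  ultimately show ?thesis
    using assms(5) by blast
qed

text \<open>Compatibility of components at \<open>r\<close> and a coarser \<open>r'\<close> is
  replaced by a common representative \<open>a\<close>: the \<open>r'\<close>-saturation of the
  \<open>r\<close>-class of \<open>a\<close> is its \<open>r'\<close>-class, by transitivity of
  \<open>r'\<close>.\<close>

lemma limit_carrierI:
  assumes "\<alpha> \<in> extensional R"
    and "\<And>r. r \<in> R \<Longrightarrow> \<alpha> r \<in> carrier M // r"
    and "\<And>r r'. r \<in> R \<Longrightarrow> r' \<in> R \<Longrightarrow> r \<subseteq> r' \<Longrightarrow>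
      \<exists>a\<in>carrier M. \<alpha> r = r `` {a} \<and> \<alpha> r' = r' `` {a}"
  shows "\<alpha> \<in> carrier L"
proof -
  have "r' `` \<alpha> r = \<alpha> r'" if rr': "r \<in> R" "r' \<in> R" "r \<subseteq> r'" for r r'
  proof -
    obtain a where a: "a \<in> carrier M" "\<alpha> r = r `` {a}" "\<alpha> r' = r' `` {a}"
      using assms(3)[OF rr'] by auto
    have "(a, a) \<in> r"
      using cong_equiv[OF rr'(1)] a(1) by (auto simp: equiv_def refl_on_def)
    moreover have "trans r'"
      using cong_equiv[OF rr'(2)] by (simp add: equiv_def)
    ultimately show ?thesis
      unfolding a(2,3) trans_def using rr'(3) by blast
  qed
  then show ?thesis
    using assms(1,2) by (auto simp: limit_monoid_def PiE_def)
qed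

lemma limit_eqI:
  assumes "\<alpha> \<in> carrier L" "\<beta> \<in> carrier L" "\<And>r. r \<in> R \<Longrightarrow> \<alpha> r = \<beta> r"
  shows "\<alpha> = \<beta>"
  using assms by (auto simp: limit_monoid_def intro: PiE_ext)

section \<open>The product and the monoid axioms\<close>

lemma limit_mult:
  assumes \<alpha>: "\<alpha> \<in> carrier L" and \<beta>: "\<beta> \<in> carrier L" and r: "r \<in> R"
    and a: "a \<in> \<alpha> r" and b: "b \<in> \<beta> (pull_cong M a r)"
  shows "(\<alpha> \<otimes>\<^bsub>L\<^esub> \<beta>) r = r `` {a \<otimes> b}"
proof -
  \<comment> \<open>All terms of the double union agree. Replacing \<open>b\<close> by
    \<open>b'\<close> stays in the class by the definition of \<open>pull_cong M a r\<close>;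
    replacing \<open>a\<close> by \<open>a'\<close> is right multiplication by \<open>b'\<close> and
    leaves that pullback unchanged.\<close>
  have "r `` {a' \<otimes> b'} = r `` {a \<otimes> b}" if a': "a' \<in> \<alpha> r" and b': "b' \<in> \<beta> (pull_cong M a' r)"
    for a' b'
  proof -
    note e = cong_equiv[OF r]
    have aM: "a \<in> carrier M" "\<alpha> r = r `` {a}"
      using limit_class[OF \<alpha> r a] .
    have aa': "(a, a') \<in> r"
      using a' aM by simp
    have "b' \<in> \<beta> (pull_cong M a r)"
      using b' pull_cong_cong[OF cong[OF r] aa'] by simp
    then have "(b, b') \<in> pull_cong M a r" and b'M: "b' \<in> carrier M"
      using limit_class[OF \<beta> pull[OF r aM(1)]] b by auto
    then have "(a \<otimes> b, a \<otimes> b') \<in> r"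
      by (simp add: pull_cong_def)
    moreover have "(a \<otimes> b', a' \<otimes> b') \<in> r"
      using right_congruence_mult[OF cong[OF r] aa' b'M] .
    ultimately have "(a \<otimes> b, a' \<otimes> b') \<in> r"
      using e unfolding equiv_def trans_def by blast
    then show ?thesis
      using equiv_class_eq[OF e] by blast
  qed
  then have "(\<Union>a\<in>\<alpha> r. \<Union>b\<in>\<beta> (pull_cong M a r). r `` {a \<otimes> b}) = r `` {a \<otimes> b}"
    using a b by blast
  then show ?thesis
    using r by (simp add: limit_monoid_def)
qed

lemma limit_mult_rep:
  assumes \<alpha>: "\<alpha> \<in> carrier L" and \<beta>: "\<beta> \<in> carrier L" and r: "r \<in> R"
  obtains a b where "a \<in> carrier M" "a \<in> \<alpha> r" "b \<in> carrier M" "b \<in> \<beta> (pull_cong M a r)"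
    "(\<alpha> \<otimes>\<^bsub>L\<^esub> \<beta>) r = r `` {a \<otimes> b}"
proof -
  obtain a where a: "a \<in> carrier M" "a \<in> \<alpha> r"
    using limit_rep[OF \<alpha> r] .
  obtain b where "b \<in> carrier M" "b \<in> \<beta> (pull_cong M a r)"
    using limit_rep[OF \<beta> pull[OF r a(1)]] .
  then show ?thesis
    using that a limit_mult[OF \<alpha> \<beta> r a(2)] by blast
qed

lemma limit_mult_cong_left:
  "\<alpha> r = \<alpha>' r \<Longrightarrow> r \<in> R \<Longrightarrow> (\<alpha> \<otimes>\<^bsub>L\<^esub> \<beta>) r = (\<alpha>' \<otimes>\<^bsub>L\<^esub> \<beta>) r"
  by (simp add: limit_monoid_def)

lemma limit_mult_cong_right:
  assumes "\<alpha> \<in> carrier L" "\<beta> \<in> carrier L" "\<beta>' \<in> carrier L" "r \<in> R" "a \<in> \<alpha> r"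
    and "\<beta> (pull_cong M a r) = \<beta>' (pull_cong M a r)"
  shows "(\<alpha> \<otimes>\<^bsub>L\<^esub> \<beta>) r = (\<alpha> \<otimes>\<^bsub>L\<^esub> \<beta>') r"
proof -
  have "a \<in> carrier M"
    using limit_class[OF assms(1,4,5)] by simp
  then obtain b where "b \<in> \<beta> (pull_cong M a r)"
    using limit_rep[OF assms(2) pull[OF assms(4)]] by blast
  then show ?thesis
    using assms limit_mult by simp
qed

text \<open>One element \<open>a \<otimes> b\<close> represents the components at both
  \<open>r\<close> and a coarser \<open>r'\<close>: \<open>a\<close> also represents the first
  factor at \<open>r'\<close>, and since pulling back is monotone, \<open>b\<close> represents the
  second factor at \<open>pull_cong M a r'\<close>.\<close>

lemma limit_mult_closed:
  assumes \<alpha>: "\<alpha> \<in> carrier L" and \<beta>: "\<beta> \<in> carrier L"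
  shows "\<alpha> \<otimes>\<^bsub>L\<^esub> \<beta> \<in> carrier L"
proof (rule limit_carrierI)
  show "\<alpha> \<otimes>\<^bsub>L\<^esub> \<beta> \<in> extensional R"
    by (simp add: limit_monoid_def)
  show "(\<alpha> \<otimes>\<^bsub>L\<^esub> \<beta>) r \<in> carrier M // r" if r: "r \<in> R" for r
    using limit_mult_rep[OF \<alpha> \<beta> r] by (metis m_closed quotientI)
  show "\<exists>a\<in>carrier M. (\<alpha> \<otimes>\<^bsub>L\<^esub> \<beta>) r = r `` {a} \<and> (\<alpha> \<otimes>\<^bsub>L\<^esub> \<beta>) r' = r' `` {a}"
    if r: "r \<in> R" and r': "r' \<in> R" and sub: "r \<subseteq> r'" for r r'
  proof -
    obtain a b where a: "a \<in> carrier M" "a \<in> \<alpha> r"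
      and bM: "b \<in> carrier M" and b: "b \<in> \<beta> (pull_cong M a r)"
      using limit_mult_rep[OF \<alpha> \<beta> r] .
    have "a \<in> \<alpha> r'"
      using limit_mono[OF \<alpha> r r' sub a(2)] .
    moreover have "b \<in> \<beta> (pull_cong M a r')"
      using limit_mono[OF \<beta> pull[OF r a(1)] pull[OF r' a(1)] pull_cong_mono[OF sub] b] .
    ultimately show ?thesis
      using limit_mult[OF \<alpha> \<beta> r a(2) b] limit_mult[OF \<alpha> \<beta> r'] a(1) bM m_closed by blast
  qed
qed

lemma limit_one_closed: "\<one>\<^bsub>L\<^esub> \<in> carrier L"
proof (rule limit_carrierI)
  show "\<one>\<^bsub>L\<^esub> r \<in> carrier M // r" if "r \<in> R" for r
    using that by (simp add: limit_monoid_def quotientI)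
  show "\<exists>a\<in>carrier M. \<one>\<^bsub>L\<^esub> r = r `` {a} \<and> \<one>\<^bsub>L\<^esub> r' = r' `` {a}"
    if "r \<in> R" "r' \<in> R" for r r'
    using that by (intro bexI[of _ \<one>]) (simp_all add: limit_monoid_def)
qed (simp add: limit_monoid_def)

lemma one_mem_limit_one: "r \<in> R \<Longrightarrow> \<one> \<in> \<one>\<^bsub>L\<^esub> r"
  using equiv_class_self[OF cong_equiv one_closed] by (simp add: limit_monoid_def)

lemma mult_mem_limit_mult:
  assumes "\<alpha> \<in> carrier L" "\<beta> \<in> carrier L" "r \<in> R" "a \<in> \<alpha> r" "b \<in> \<beta> (pull_cong M a r)"
  shows "a \<otimes> b \<in> (\<alpha> \<otimes>\<^bsub>L\<^esub> \<beta>) r"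
proof -
  have a: "a \<in> carrier M"
    using limit_class[OF assms(1,3,4)] by simp
  then have "b \<in> carrier M"
    using limit_class[OF assms(2) pull[OF assms(3)] assms(5)] by simp
  then show ?thesis
    using limit_mult[OF assms] equiv_class_self[OF cong_equiv[OF assms(3)]] a by simp
qed

text \<open>Representatives \<open>a\<close>, \<open>b\<close>, \<open>c\<close> are chosen in turn
  at \<open>r\<close>, at its pullback along \<open>a\<close>, and at the further pullback along
  \<open>b\<close>. The last is the pullback of \<open>r\<close> along \<open>a \<otimes> b\<close>,
  so both bracketings are computed by the same three elements and associativity descends from
  \<open>M\<close>.\<close>

lemma monoid_limit: "monoid L"
proof (rule monoidI)
  fix \<alpha> \<beta> \<gamma> assume \<alpha>: "\<alpha> \<in> carrier L" and \<beta>: "\<beta> \<in> carrier L" and \<gamma>: "\<gamma> \<in> carrier L"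
  show "(\<alpha> \<otimes>\<^bsub>L\<^esub> \<beta>) \<otimes>\<^bsub>L\<^esub> \<gamma> = \<alpha> \<otimes>\<^bsub>L\<^esub> (\<beta> \<otimes>\<^bsub>L\<^esub> \<gamma>)"
  proof (rule limit_eqI)
    fix r assume r: "r \<in> R"
    obtain a b where a: "a \<in> carrier M" "a \<in> \<alpha> r"
      and b: "b \<in> carrier M" "b \<in> \<beta> (pull_cong M a r)"
      using limit_mult_rep[OF \<alpha> \<beta> r] .
    note ra = pull[OF r a(1)]
    obtain c where c: "c \<in> carrier M" "c \<in> \<gamma> (pull_cong M b (pull_cong M a r))"
      using limit_rep[OF \<gamma> pull[OF ra b(1)]] .
    have "((\<alpha> \<otimes>\<^bsub>L\<^esub> \<beta>) \<otimes>\<^bsub>L\<^esub> \<gamma>) r = r `` {(a \<otimes> b) \<otimes> c}"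
      using limit_mult[OF limit_mult_closed[OF \<alpha> \<beta>] \<gamma> r mult_mem_limit_mult[OF \<alpha> \<beta> r a(2) b(2)]]
        c(2) a(1) b(1) by (simp add: pull_cong_mult)
    moreover have "(\<alpha> \<otimes>\<^bsub>L\<^esub> (\<beta> \<otimes>\<^bsub>L\<^esub> \<gamma>)) r = r `` {a \<otimes> (b \<otimes> c)}"
      using limit_mult[OF \<alpha> limit_mult_closed[OF \<beta> \<gamma>] r a(2)
          mult_mem_limit_mult[OF \<beta> \<gamma> ra b(2) c(2)]] .
    ultimately show "((\<alpha> \<otimes>\<^bsub>L\<^esub> \<beta>) \<otimes>\<^bsub>L\<^esub> \<gamma>) r = (\<alpha> \<otimes>\<^bsub>L\<^esub> (\<beta> \<otimes>\<^bsub>L\<^esub> \<gamma>)) r"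
      using a(1) b(1) c(1) by (simp add: m_assoc)
  qed (simp_all add: \<alpha> \<beta> \<gamma> limit_mult_closed)
next
  fix \<alpha> assume \<alpha>: "\<alpha> \<in> carrier L"
  note one = limit_one_closed
  show "\<one>\<^bsub>L\<^esub> \<otimes>\<^bsub>L\<^esub> \<alpha> = \<alpha>"
  proof (rule limit_eqI)
    fix r assume r: "r \<in> R"
    obtain a where a: "a \<in> carrier M" "a \<in> \<alpha> r" "\<alpha> r = r `` {a}"
      using limit_rep[OF \<alpha> r] .
    then show "(\<one>\<^bsub>L\<^esub> \<otimes>\<^bsub>L\<^esub> \<alpha>) r = \<alpha> r"
      using limit_mult[OF one \<alpha> r one_mem_limit_one[OF r]] pull_cong_one[OF cong[OF r]] by simp
  qed (simp_all add: \<alpha> one limit_mult_closed)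
  show "\<alpha> \<otimes>\<^bsub>L\<^esub> \<one>\<^bsub>L\<^esub> = \<alpha>"
  proof (rule limit_eqI)
    fix r assume r: "r \<in> R"
    obtain a where a: "a \<in> carrier M" "a \<in> \<alpha> r" "\<alpha> r = r `` {a}"
      using limit_rep[OF \<alpha> r] .
    then show "(\<alpha> \<otimes>\<^bsub>L\<^esub> \<one>\<^bsub>L\<^esub>) r = \<alpha> r"
      using limit_mult[OF \<alpha> one r a(2) one_mem_limit_one[OF pull[OF r a(1)]]] by simp
  qed (simp_all add: \<alpha> one limit_mult_closed)
qed (simp_all add: limit_mult_closed limit_one_closed)

section \<open>Subbasic open sets and the action topology\<close>

definition cylinder :: "('a \<times> 'a) set \<Rightarrow> 'a set set \<Rightarrow> (('a \<times> 'a) set \<Rightarrow> 'a set) set" where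
  "cylinder r S = {\<alpha> \<in> carrier L. \<alpha> r \<in> S}"

abbreviation "subbase \<equiv> insert (carrier L) {cylinder r S | r S. r \<in> R \<and> S \<subseteq> carrier M // r}"

lemma limit_topology_eq: "limit_topology M R = topology_generated_by subbase"
  by (simp add: limit_topology_def cylinder_def)

lemma topspace_limit: "topspace (limit_topology M R) = carrier L"
  by (auto simp: limit_topology_eq cylinder_def)

lemma openin_cylinder:
  assumes "r \<in> R"
  shows "openin (limit_topology M R) (cylinder r S)"
proof -
  \<comment> \<open>Here \<open>S\<close> is arbitrary, whereas a generator needs a subset of
    \<open>M/r\<close>; as components always lie in \<open>M/r\<close>, intersecting changes
    nothing.\<close>
  have "cylinder r S = cylinder r (S \<inter> carrier M // r)"
    using assms by (auto simp: cylinder_def limit_monoid_def)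
  also have "openin (limit_topology M R) \<dots>"
    unfolding limit_topology_eq using assms by (intro topology_generated_by_Basis) blast
  finally show ?thesis .
qed

text \<open>With \<open>a\<close> in \<open>q r\<close>, whether \<open>q\<close> times
  \<open>m\<close> times \<open>\<beta>\<close> lies in the cylinder depends on \<open>m\<close>
  only through its component at \<open>pull_cong M a r\<close>. Each point of a necessary clopen
  therefore has a cylinder neighbourhood inside it.\<close>

lemma cylinder_in_action_base:
  assumes r: "r \<in> R"
  shows "cylinder r S \<in> action_base L (limit_topology M R)"
proof -
  interpret L: monoid L by (rule monoid_limit)
  have "openin (limit_topology M R) (nec_clopen L (pull_set L q (cylinder r S)) p)"
    (is "openin _ ?I") if p: "p \<in> carrier L" and q: "q \<in> carrier L" for p q
  proof (subst openin_subopen, intro ballI)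
    fix m assume m: "m \<in> ?I"
    then have mL: "m \<in> carrier L"
      by (simp add: nec_clopen_def)
    obtain a where a: "a \<in> carrier M" "a \<in> q r"
      using limit_rep[OF q r] .
    let ?s = "pull_cong M a r"
    let ?W = "cylinder ?s {m ?s}"
    have eq: "(q \<otimes>\<^bsub>L\<^esub> (m' \<otimes>\<^bsub>L\<^esub> \<beta>)) r = (q \<otimes>\<^bsub>L\<^esub> (m \<otimes>\<^bsub>L\<^esub> \<beta>)) r"
      if m': "m' \<in> ?W" and \<beta>: "\<beta> \<in> carrier L" for m' \<beta>
    proof (rule limit_mult_cong_right[OF q _ _ r a(2)])
      show "(m' \<otimes>\<^bsub>L\<^esub> \<beta>) ?s = (m \<otimes>\<^bsub>L\<^esub> \<beta>) ?s"
        using m' by (intro limit_mult_cong_left pull[OF r a(1)]) (simp add: cylinder_def)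
    qed (use m' mL \<beta> in \<open>simp_all add: cylinder_def\<close>)
    have "?W \<subseteq> ?I"
    proof
      fix m' assume m': "m' \<in> ?W"
      then have m'L: "m' \<in> carrier L"
        by (simp add: cylinder_def)
      have "pull_set L m' (pull_set L q (cylinder r S)) = pull_set L m (pull_set L q (cylinder r S))"
        using eq[OF m'] m'L mL q by (auto simp: pull_set_def cylinder_def)
      then show "m' \<in> ?I"
        using m m'L by (simp add: nec_clopen_def)
    qed
    moreover have "m \<in> ?W"
      using mL by (simp add: cylinder_def)
    ultimately show "\<exists>V. openin (limit_topology M R) V \<and> m \<in> V \<and> V \<subseteq> ?I"
      using openin_cylinder[OF pull[OF r a(1)]] by blast
  qed
  then show ?thesis
    by (auto simp: action_base_def cylinder_def)
qed

section \<open>Continuity of the product and separation\<close>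

lemma continuous_map_limit_mult:
  "continuous_map (prod_topology (limit_topology M R) (limit_topology M R)) (limit_topology M R)
    (\<lambda>(\<alpha>, \<beta>). \<alpha> \<otimes>\<^bsub>L\<^esub> \<beta>)" (is "continuous_map ?P _ ?f")
proof -
  have top: "topspace ?P = carrier L \<times> carrier L"
    by (simp add: topspace_limit)
  have "openin ?P (?f -` B \<inter> topspace ?P)" if B: "B \<in> subbase" for B
  proof -
    consider "B = carrier L" | r S where "r \<in> R" "B = cylinder r S"
      using B by blast
    then show ?thesis
    proof cases
      case 1
      then have "?f -` B \<inter> topspace ?P = topspace ?P"
        using limit_mult_closed by (auto simp: topspace_limit)
      then show ?thesis
        by (metis openin_topspace)
    next
      case (2 r S)
      note r = 2(1)
      show ?thesis
      \<comment> \<open>Openness is checked pointwise because the index constraining the second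
        factor comes from a representative \<open>a\<close> of the first. Near the given point the
        \<open>r\<close>-component of the first factor is frozen, so the same \<open>a\<close>
        serves throughout.\<close>
      proof (subst openin_subopen, intro ballI)
        fix x assume x: "x \<in> ?f -` B \<inter> topspace ?P"
        then obtain \<alpha> \<beta> where x_eq: "x = (\<alpha>, \<beta>)" and \<alpha>: "\<alpha> \<in> carrier L" and \<beta>: "\<beta> \<in> carrier L"
          unfolding top by blast
        obtain a where a: "a \<in> carrier M" "a \<in> \<alpha> r"
          using limit_rep[OF \<alpha> r] .
        let ?s = "pull_cong M a r"
        let ?W = "cylinder r {\<alpha> r} \<times> cylinder ?s {\<beta> ?s}"
        have "openin ?P ?W"
          using openin_cylinder r pull[OF r a(1)] by (simp add: openin_prod_Times_iff)
        moreover have "x \<in> ?W"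
          using \<alpha> \<beta> by (simp add: x_eq cylinder_def)
        moreover have "?W \<subseteq> ?f -` B \<inter> topspace ?P"
        proof
          fix y assume "y \<in> ?W"
          then obtain \<alpha>' \<beta>' where y: "y = (\<alpha>', \<beta>')" and \<alpha>': "\<alpha>' \<in> carrier L" "\<alpha>' r = \<alpha> r"
            and \<beta>': "\<beta>' \<in> carrier L" "\<beta>' ?s = \<beta> ?s"
            by (auto simp: cylinder_def)
          have "(\<alpha>' \<otimes>\<^bsub>L\<^esub> \<beta>') r = (\<alpha> \<otimes>\<^bsub>L\<^esub> \<beta>') r"
            using \<alpha>'(2) r by (rule limit_mult_cong_left)
          also have "\<dots> = (\<alpha> \<otimes>\<^bsub>L\<^esub> \<beta>) r"
            using \<alpha> \<beta>'(1) \<beta> r a(2) \<beta>'(2) by (rule limit_mult_cong_right)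
          finally show "y \<in> ?f -` B \<inter> topspace ?P"
            using x \<alpha>' \<beta>' limit_mult_closed by (simp add: y x_eq 2(2) cylinder_def topspace_limit)
        qed
        ultimately show "\<exists>V. openin ?P V \<and> x \<in> V \<and> V \<subseteq> ?f -` B \<inter> topspace ?P"
          by blast
      qed
    qed
  qed
  moreover have "?f ` topspace ?P \<subseteq> \<Union> subbase"
    using limit_mult_closed by (auto simp: topspace_limit)
  ultimately have "continuous_map ?P (topology_generated_by subbase) ?f"
    by (rule continuous_on_generated_topo)
  then show ?thesis
    by (simp add: limit_topology_eq)
qed

text \<open>Elements of \<open>L\<close> are determined by their components, so distinct ones differ
  at some \<open>r\<close>, and the cylinder over the single class \<open>\<alpha> r\<close>
  separates them.\<close>

lemma t0_space_limit: "t0_space (limit_topology M R)"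
proof -
  have "\<exists>V. openin (limit_topology M R) V \<and> (\<alpha> \<notin> V \<longleftrightarrow> \<beta> \<in> V)"
    if "\<alpha> \<in> carrier L" "\<beta> \<in> carrier L" "\<alpha> \<noteq> \<beta>" for \<alpha> \<beta>
  proof -
    obtain r where "r \<in> R" "\<alpha> r \<noteq> \<beta> r"
      using limit_eqI[OF \<open>\<alpha> \<in> carrier L\<close> \<open>\<beta> \<in> carrier L\<close>] \<open>\<alpha> \<noteq> \<beta>\<close> by auto
    then show ?thesis
      using openin_cylinder[of r "{\<alpha> r}"] that
      by (intro exI[of _ "cylinder r {\<alpha> r}"]) (auto simp: cylinder_def)
  qed
  then show ?thesis
    by (simp add: t0_space_def topspace_limit)
qed

theorem powder_monoid_limit: "powder_monoid L (limit_topology M R)"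
proof -
  have "subbase \<subseteq> action_base L (topology_generated_by subbase)"
    using cylinder_in_action_base carrier_in_action_base[OF monoid_limit topspace_limit]
    unfolding limit_topology_eq by auto
  then have "action_topology L (limit_topology M R)"
    using action_topologyI[OF monoid_limit] topspace_limit unfolding limit_topology_eq by blast
  then show ?thesis
    by (simp add: powder_monoid_def topological_monoid_def monoid_limit topspace_limit
        continuous_map_limit_mult t0_space_limit)
qed

end

section \<open>Congruences in the essential image\<close>

text \<open>Closure under subobjects is phrased through monic arrows, so a sub-\<open>M\<close>-set
  has to be presented as the domain of one. Cancelling the inclusion gives equality on points of
  \<open>W\<close>; extensionality gives it elsewhere.\<close>

lemma monic_PSh_inclusion:
  assumes "right_mset M X" "points X \<in> U" "right_mset M Y" "points Y \<in> U"
    and "equivariant M Y X (\<lambda>y. y)"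
  shows "monic (PSh U M) (Y, restrict (\<lambda>y. y) (points Y), X)" (is "monic _ ?i")
proof -
  have YX: "points Y \<subseteq> points X"
    using assms(5) by (auto simp: equivariant_def)
  have "equivariant M Y X (restrict (\<lambda>y. y) (points Y))"
    using assms(3,5) by (auto simp: equivariant_def right_mset_def)
  then have arr: "?i \<in> Arr (PSh U M)"
    using assms(1-4) by (simp add: PSh_def)
  have "f = g" if f: "f \<in> Hom (PSh U M) W Y" and g: "g \<in> Hom (PSh U M) W Y"
    and eq: "?i \<Zcomp>\<^bsub>PSh U M\<^esub> f = ?i \<Zcomp>\<^bsub>PSh U M\<^esub> g" for W f g
  proof -
    obtain f' where f': "f = (W, f', Y)" "f' \<in> points W \<rightarrow> points Y" "f' \<in> extensional (points W)"
      using f by (auto simp: Hom_def PSh_def equivariant_def)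
    obtain g' where g': "g = (W, g', Y)" "g' \<in> points W \<rightarrow> points Y" "g' \<in> extensional (points W)"
      using g by (auto simp: Hom_def PSh_def equivariant_def)
    have c: "compose (points W) (restrict (\<lambda>y. y) (points Y)) f'
        = compose (points W) (restrict (\<lambda>y. y) (points Y)) g'"
      using eq f' g' by (simp add: PSh_def)
    have "f' w = g' w" if "w \<in> points W" for w
      using fun_cong[OF c, of w] f'(2) g'(2) that by (auto simp: compose_def Pi_iff)
    then show ?thesis
      using f' g' extensionalityI by blast
  qed
  moreover have "Dom (PSh U M) ?i = Y"
    by (simp add: PSh_def)
  ultimately show ?thesis
    using arr by (simp add: monic_def)
qed

text \<open>The embedding of the pulled-back quotient into \<open>M/r\<close> is carried along
  \<open>f\<close> into \<open>X\<close>, an actual object of \<open>PSh U G\<close>. Its image is a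
  subobject of \<open>X\<close>, hence in the essential image.\<close>

lemma (in monoid) pull_cong_in_congs_of:
  assumes "universe U"
    and closed: "closed_under_subobjects (PSh U G) (essential_image E (PSh U G) (inverse_image h))"
    and r: "r \<in> congs_of U G E h" and m: "m \<in> carrier G"
  shows "pull_cong G m r \<in> congs_of U G E h"
proof -
  interpret universe U by fact
  let ?s = "pull_cong G m r"
  obtain X f where rc: "right_congruence G r"
    and X: "X \<in> essential_image E (PSh U G) (inverse_image h)"
    and f: "equivariant G (quotient_mset G r) X f"
    and bij: "bij_betw f (points (quotient_mset G r)) (points X)"
    using r by (auto simp: congs_of_def)
  have XU: "right_mset G X" "points X \<in> U"
    using X by (auto simp: essential_image_def PSh_def)
  have sc: "right_congruence G ?s"
    using rc m by (rule right_congruence_pull_cong)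
  note er = right_congruence_equiv[OF rc] and es = right_congruence_equiv[OF sc]
  have pts: "points (quotient_mset G t) = carrier G // t" for t
    by (simp add: quotient_mset_def)
  define k where "k x = f (r `` {m \<otimes> x})" for x
  have kX: "k x \<in> points X" if "x \<in> carrier G" for x
    using f that m by (auto simp: k_def equivariant_def pts intro: quotientI)
  have k_act: "act X (k x) n = k (x \<otimes> n)" if "x \<in> carrier G" "n \<in> carrier G" for x n
  proof -
    have "act X (k x) n = f (act (quotient_mset G r) (r `` {m \<otimes> x}) n)"
      using f that m by (simp add: k_def equivariant_def pts quotientI)
    then show ?thesis
      using act_quotient_mset[OF rc] that m by (simp add: k_def m_assoc)
  qed
  have k_eq: "k x = k y \<longleftrightarrow> (x, y) \<in> ?s" if "x \<in> carrier G" "y \<in> carrier G" for x y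
  proof -
    have "k x = k y \<longleftrightarrow> r `` {m \<otimes> x} = r `` {m \<otimes> y}"
      unfolding k_def using that m
      by (subst inj_on_eq_iff[OF bij_betw_imp_inj_on[OF bij]]) (simp_all add: pts quotientI)
    also have "\<dots> \<longleftrightarrow> (x, y) \<in> ?s"
      using eq_equiv_class_iff[OF er] that m by (simp add: pull_cong_def)
    finally show ?thesis .
  qed
  define Y where "Y = \<lparr>points = k ` carrier G, act = act X\<rparr>"
  have YX: "points Y \<subseteq> points X"
    using kX by (auto simp: Y_def)
  have Y: "right_mset G Y"
    unfolding right_mset_def
  proof (intro conjI ballI)
    fix y n assume "y \<in> points Y" "n \<in> carrier G"
    then show "act Y y n \<in> points Y"
      using k_act by (auto simp: Y_def)
  qed (use XU(1) YX in \<open>auto simp: right_mset_def Y_def\<close>)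
  have "points Y \<in> U"
    using XU(2) YX by (rule subset)
  moreover have "equivariant G Y X (\<lambda>y. y)"
    using YX by (auto simp: equivariant_def Y_def)
  ultimately have "monic (PSh U G) (Y, restrict (\<lambda>y. y) (points Y), X)"
    using XU Y by (intro monic_PSh_inclusion)
  then have Y_ess: "Y \<in> essential_image E (PSh U G) (inverse_image h)"
    using closed X by (fastforce simp: closed_under_subobjects_def PSh_def)
  \<comment> \<open>The map induced by \<open>k\<close> on classes of \<open>?s\<close>. The chosen
    representative is immaterial since \<open>k\<close> is constant on classes; it is injective
    since \<open>k\<close> identifies nothing more.\<close>
  define g where "g c = k (SOME x. x \<in> c)" for c
  have g: "g (?s `` {x}) = k x" if x: "x \<in> carrier G" for x
  proof -
    let ?y = "SOME y. y \<in> ?s `` {x}"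
    have "?y \<in> ?s `` {x}"
      using equiv_class_self[OF es x] by (rule someI)
    then have xy: "(x, ?y) \<in> ?s"
      by (rule ImageE) simp
    then have "?y \<in> carrier G"
      using right_congruence_subset[OF sc] by blast
    then show ?thesis
      using k_eq[OF x, of ?y] xy by (simp add: g_def)
  qed
  have "equivariant G (quotient_mset G ?s) Y g"
    unfolding equivariant_def pts
  proof (intro conjI funcsetI ballI)
    fix c assume "c \<in> carrier G // ?s"
    then obtain x where c: "c = ?s `` {x}" and x: "x \<in> carrier G"
      by (rule quotientE)
    show "g c \<in> points Y"
      using g[OF x] x by (simp add: c Y_def)
    show "g (act (quotient_mset G ?s) c n) = act Y (g c) n" if n: "n \<in> carrier G" for n
      using act_quotient_mset[OF sc x n] k_act[OF x n] g[OF x] g[OF m_closed[OF x n]]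
      by (simp add: c Y_def)
  qed
  moreover have "bij_betw g (carrier G // ?s) (points Y)"
    unfolding bij_betw_def
  proof
    show "inj_on g (carrier G // ?s)"
    proof (rule inj_onI)
      fix c d assume "c \<in> carrier G // ?s" "d \<in> carrier G // ?s" and eq: "g c = g d"
      then obtain x y where c: "c = ?s `` {x}" "x \<in> carrier G" and d: "d = ?s `` {y}" "y \<in> carrier G"
        by (meson quotientE)
      then show "c = d"
        using eq g k_eq[OF c(2) d(2)] equiv_class_eq[OF es, of x y] by simp
    qed
    show "g ` (carrier G // ?s) = points Y"
    proof
      show "g ` (carrier G // ?s) \<subseteq> points Y"
        by (auto elim!: quotientE simp: g Y_def)
      show "points Y \<subseteq> g ` (carrier G // ?s)"
      proof
        fix y assume "y \<in> points Y"
        then obtain x where x: "x \<in> carrier G" "y = g (?s `` {x})"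
          by (auto simp: Y_def g)
        then show "y \<in> g ` (carrier G // ?s)"
          using quotientI[of x "carrier G" ?s] by blast
      qed
    qed
  qed
  ultimately show ?thesis
    using sc Y_ess pts unfolding congs_of_def by auto
qed

theorem proposition3p22:
  fixes M :: "('a, 'b) monoid_scheme"
    and U :: "'u set set"
    and E :: "('o, 'm) cat"
    and h :: "(('u, 'a) mset, ('u, 'a) mset \<times> ('u \<Rightarrow> 'u) \<times> ('u, 'a) mset, 'o, 'm) geom_morphism"
  assumes "universe U"
    and "monoid M"
    and "small U (carrier M)"
    and "topos E"
    and "hyperconnected (PSh U M) E h"
  shows "powder_monoid (limit_monoid M (congs_of U M E h)) (limit_topology M (congs_of U M E h))"
proof -
  interpret monoid M by fact
  have "closed_under_subobjects (PSh U M) (essential_image E (PSh U M) (inverse_image h))"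
    using assms(5) by (simp add: hyperconnected_def)
  \<comment> \<open>Being a right congruence is part of membership in \<open>congs_of\<close>;
    closure under pullback comes from closure of the essential image under subobjects.\<close>
  then interpret pull_closed_congruences M "congs_of U M E h"
    by unfold_locales (simp add: congs_of_def, rule pull_cong_in_congs_of[OF assms(1)])
  show ?thesis
    by (rule powder_monoid_limit)
qed

end
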